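(* The normal suspense number $S^+$ of paths is non-decreasing in $n$, and for every $n\ge 0$: 1. $S^+(P_{5(2^n-1)})=2n$; 2. $S^+(P_k)=2n+1$ for every $k$ with $5(2^n-1)+1\le k\le 5(2^{n+1}-1)-2$; 3. $S^+(P_{5(2^{n+1}-1)-1})=2n+2$.
   Context: For $n\ge 0$, $P_n$ denotes the path on $n$ vertices ($P_0$ is the empty graph). A Node-Kayles move on a path $P_k$ with $k\ge 1$ chooses a vertex and deletes it together with its neighbours. The possible results are: $P_0$ if $k\in\{1,2\}$; $P_0$ or $P_1$ if $k=3$; and, for $k\ge 4$, $P_{k-2}$, $P_{k-3}$, or two paths $P_i,P_j$ with $j\ge i\ge1$, $i+j=k-3$. In the continued conjunctive compound game, a position $G$ is a finite multiset of paths (components). A move replaces every nonempty component simultaneously by the result of a Node-Kayles move on it; a split component yields two components. The set $O(G)$ of options of $G$ consists of all positions obtainable by one such move, and $O(G)=\emptyset$ exactly when all components are empty. The normal suspense number $S^+$ is defined recursively as follows: - $S^+(G)=0$ if $O(G)=\emptyset$; - $S^+(G)=1+\max\{S^+(G'):G'\in O(G),\ S^+(G')\text{ even}\}$ if some option has even suspense number; - $S^+(G)=1+\min\{S^+(G'):G'\in O(G)\}$ otherwise, in which case all these values are odd. $S^+(P_n)$ denotes the suspense number of the single component $P_n$. *)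

theory Defs
  imports Main "HOL-Library.Multiset"
begin

text \<open>
  The path on \<open>n\<close> vertices is represented by \<open>n\<close>, so a position is a multiset of natural
  numbers; empty components (\<open>0\<close>) are kept as elements of the multiset.
\<close>

type_synonym position = "nat multiset"

definition nk_results :: "nat \<Rightarrow> position set" where
  "nk_results k =
    (if k = 0 then {}
     else if k = 1 \<or> k = 2 then {{#0#}}
     else if k = 3 then {{#0#}, {#1#}}
     else {{#k - 2#}, {#k - 3#}} \<union> {{#i, j#} | i j. 1 \<le> i \<and> i \<le> j \<and> i + j = k - 3})"

text \<open>Empty components are left untouched by a compound move.\<close>

definition component_results :: "nat \<Rightarrow> position set" where
  "component_results k = (if k = 0 then {{#0#}} else nk_results k)"

text \<open>
  In \<open>options\<close>, the multiset \<open>N\<close> collects one chosen result for each component of \<open>G\<close>; equal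
  components may receive different results.
\<close>

definition options :: "position \<Rightarrow> position set" where
  "options G =
    (if \<forall>k\<in>#G. k = 0 then {}
     else {\<Sum>\<^sub># N | N. rel_mset (\<lambda>k r. r \<in> component_results k) G N})"

lemma finite_nk_results: "finite (nk_results k)"
proof -
  have "{{#i, j#} | i j. 1 \<le> i \<and> i \<le> j \<and> i + j = k - 3}
      \<subseteq> (\<lambda>(i, j). {#i, j#}) ` ({..k} \<times> {..k})"
    by force
  then have "finite {{#i, j#} | i j. 1 \<le> i \<and> i \<le> j \<and> i + j = k - 3}"
    by (rule finite_subset) simp
  then show ?thesis
    by (simp add: nk_results_def)
qed

lemma component_results_nonempty: "component_results k \<noteq> {}"
  by (auto simp: component_results_def nk_results_def)

lemma sum_component_results:
  assumes "r \<in> component_results k"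
  shows "\<Sum>\<^sub># r \<le> k" "k \<noteq> 0 \<Longrightarrow> \<Sum>\<^sub># r < k"
  using assms by (auto simp: component_results_def nk_results_def split: if_splits)

lemma rel_mset_add_mset_left:
  "{N. rel_mset R (add_mset k G) N} = (\<Union>r\<in>{r. R k r}. add_mset r ` {N. rel_mset R G N})"
  by (auto dest!: msed_rel_invL intro: rel_mset_Plus)

lemma finite_choices: "finite {N. rel_mset (\<lambda>k r. r \<in> component_results k) G N}"
proof (induction G)
  case empty
  have "{N. rel_mset (\<lambda>k r. r \<in> component_results k) {#} N} \<subseteq> {{#}}"
    by (auto dest: rel_mset_size)
  then show ?case
    by (rule finite_subset) simp
next
  case (add k G)
  have "finite (component_results k)"
    by (simp add: component_results_def finite_nk_results)
  with add show ?case
    by (auto simp: rel_mset_add_mset_left)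
qed

lemma choices_nonempty: "\<exists>N. rel_mset (\<lambda>k r. r \<in> component_results k) G N"
proof (induction G)
  case empty
  show ?case by (auto intro: rel_mset_Zero)
next
  case (add k G)
  then show ?case
    using component_results_nonempty[of k] by (blast intro: rel_mset_Plus)
qed

lemma options_finite: "finite (options G)"
proof -
  have "{\<Sum>\<^sub># N | N. rel_mset (\<lambda>k r. r \<in> component_results k) G N}
      = \<Sum>\<^sub># ` {N. rel_mset (\<lambda>k r. r \<in> component_results k) G N}"
    by blast
  then show ?thesis
    by (simp add: options_def finite_choices)
qed

lemma options_eq_empty_iff: "options G = {} \<longleftrightarrow> (\<forall>k\<in>#G. k = 0)"
  using choices_nonempty[of G] by (auto simp: options_def)

lemma sum_choices:
  assumes "rel_mset (\<lambda>k r. r \<in> component_results k) G N"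
  shows "\<Sum>\<^sub># (\<Sum>\<^sub># N) \<le> \<Sum>\<^sub># G \<and> ((\<exists>k\<in>#G. k \<noteq> 0) \<longrightarrow> \<Sum>\<^sub># (\<Sum>\<^sub># N) < \<Sum>\<^sub># G)"
  using assms
proof (induction G arbitrary: N)
  case empty
  then have "N = {#}" by (auto dest: rel_mset_size)
  then show ?case by simp
next
  case (add k G)
  from add.prems obtain N' r where N: "N = add_mset r N'"
    and r: "r \<in> component_results k"
    and N': "rel_mset (\<lambda>k r. r \<in> component_results k) G N'"
    by (auto dest!: msed_rel_invL)
  have k: "\<Sum>\<^sub># r \<le> k" "k \<noteq> 0 \<Longrightarrow> \<Sum>\<^sub># r < k"
    using sum_component_results[OF r] by auto
  show ?case
  proof (cases "k = 0")
    case True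
    then have "\<Sum>\<^sub># r = 0" using k by simp
    then show ?thesis using add.IH[OF N'] True by (simp add: N del: sum_mset_0_iff)
  next
    case False
    then show ?thesis using add.IH[OF N'] k by (simp add: N add_less_le_mono)
  qed
qed

lemma sum_options_less: "G' \<in> options G \<Longrightarrow> \<Sum>\<^sub># G' < \<Sum>\<^sub># G"
  using sum_choices by (fastforce simp: options_def split: if_splits)

function suspense :: "position \<Rightarrow> nat" where
  "suspense G =
    (let V = suspense ` options G in
     if options G = {} then 0
     else if \<exists>s\<in>V. even s then 1 + Max {s \<in> V. even s}
     else 1 + Min V)"
  by pat_completeness auto
termination
  by (relation "Wellfounded.measure (\<lambda>G. \<Sum>\<^sub># G)") (auto simp: sum_options_less)

declare suspense.simps [simp del]

abbreviation suspense_path :: "nat \<Rightarrow> nat" where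
  "suspense_path n \<equiv> suspense {#n#}"

end

theory Submission
  imports Defs
begin

text \<open>
  The rule computing a suspense number from those of the options commutes with maxima, hence the
  suspense number of a position is the maximum over its components. If the suspense numbers of
  shorter paths are non-decreasing and \<open>k \<ge> 4\<close>, a split \<open>P\<^sub>i, P\<^sub>j\<close> with \<open>i \<le> j\<close> therefore has the value of
  \<open>P\<^sub>j\<close>, and the options of \<open>P\<^sub>k\<close> have exactly the values of the paths in the window from
  \<open>(k - 2) div 2\<close> to \<open>k - 2\<close>. With \<open>A = 5 (2\<^sup>n - 1)\<close>, this window meets the last even plateau
  \<open>{A - 1, A}\<close> precisely for \<open>A < k \<le> 2 A + 3\<close>, and for \<open>k = 2 A + 4\<close> and \<open>k = 2 A + 5\<close> it
  contains only the odd value \<open>2 n + 1\<close>.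
\<close>

section \<open>The suspense rule on sets of values, and maxima\<close>

definition suspense_step :: "nat set \<Rightarrow> nat" where
  "suspense_step V = (if \<exists>s\<in>V. even s then 1 + Max {s \<in> V. even s} else 1 + Min V)"

lemma suspense_step_even:
  assumes "finite V" "e \<in> V" "even e" "\<And>v. v \<in> V \<Longrightarrow> even v \<Longrightarrow> v \<le> e"
  shows "suspense_step V = Suc e"
proof -
  have "Max {s \<in> V. even s} = e"
    using assms by (intro Max_eqI) auto
  then show ?thesis
    using assms by (auto simp: suspense_step_def)
qed

lemma suspense_step_odd:
  assumes "finite V" "m \<in> V" "\<And>v. v \<in> V \<Longrightarrow> odd v \<and> m \<le> v"
  shows "suspense_step V = Suc m"
proof -
  have "Min V = m"
    using assms by (intro Min_eqI) auto
  then show ?thesis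
    using assms by (auto simp: suspense_step_def)
qed

lemma suspense_step_cases:
  assumes "finite V" "V \<noteq> {}"
  obtains e where "e \<in> V" "even e" "\<And>v. v \<in> V \<Longrightarrow> even v \<Longrightarrow> v \<le> e" "suspense_step V = Suc e"
  | m where "m \<in> V" "\<And>v. v \<in> V \<Longrightarrow> odd v \<and> m \<le> v" "suspense_step V = Suc m"
proof (cases "\<exists>s\<in>V. even s")
  case True
  then have "Max {s \<in> V. even s} \<in> {s \<in> V. even s}"
    using assms by (intro Max_in) auto
  moreover have "v \<le> Max {s \<in> V. even s}" if "v \<in> V" "even v" for v
    using assms that by (intro Max_ge) auto
  ultimately show ?thesis
    using True by (intro that(1)[of "Max {s \<in> V. even s}"]) (auto simp: suspense_step_def)
next
  case False
  then show ?thesis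
    using assms by (intro that(2)[of "Min V"]) (auto simp: suspense_step_def)
qed

text \<open>All of \<open>W\<close> is odd, so an even maximum comes from \<open>V\<close> and is at
  most \<open>e\<close>. If \<open>m < e\<close>, then \<open>e\<close> itself is such a maximum.
  Otherwise \<open>e < m\<close> by parity: every even \<open>v\<close> is absorbed by some
  \<open>w >= m\<close>, no even value survives, and \<open>m\<close> is the least maximum.\<close>

lemma suspense_step_max_mixed:
  assumes "finite V" "finite W"
    and e: "e \<in> V" "even e" "\<And>v. v \<in> V \<Longrightarrow> even v \<Longrightarrow> v \<le> e"
    and m: "m \<in> W" "\<And>w. w \<in> W \<Longrightarrow> odd w \<and> m \<le> w"
  shows "suspense_step {max v w | v w. v \<in> V \<and> w \<in> W} = Suc (max e m)"
proof -
  let ?M = "{max v w | v w. v \<in> V \<and> w \<in> W}"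
  have fin: "finite ?M"
    using assms(1,2) by (intro finite_image_set2) auto
  have mem: "max e m \<in> ?M"
    using e(1) m(1) by blast
  show ?thesis
  proof (cases "m < e")
    case True
    have "u \<le> max e m" if "u \<in> ?M" "even u" for u
      using that e(3) m(2) True by (force simp: max_def split: if_splits)
    then show ?thesis
      using fin mem e(2) True by (intro suspense_step_even) (auto simp: max_def)
  next
    case False
    have "odd u \<and> max e m \<le> u" if "u \<in> ?M" for u
    proof -
      from that obtain v w where vw: "u = max v w" "v \<in> V" "w \<in> W" by blast
      have "e < m" using False e(2) m by (metis linorder_neqE_nat)
      then show ?thesis
        using vw e(3)[of v] m(2)[of w] by (cases "even v") (auto simp: max_def)
    qed
    then show ?thesis
      using fin mem by (intro suspense_step_odd) auto
  qed
qed

text \<open>When both sets contain even values, the largest even ones combine; when both are all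
  odd, the minima combine. The mixed case has its own lemma, applied with the sets swapped if
  needed.\<close>

lemma suspense_step_max:
  assumes V: "finite V" "V \<noteq> {}" and W: "finite W" "W \<noteq> {}"
  shows "suspense_step {max v w | v w. v \<in> V \<and> w \<in> W}
    = max (suspense_step V) (suspense_step W)"
proof -
  let ?M = "{max v w | v w. v \<in> V \<and> w \<in> W}"
  have fin: "finite ?M"
    using V(1) W(1) by (intro finite_image_set2) auto
  have comm: "?M = {max w v | w v. w \<in> W \<and> v \<in> V}"
    by (auto simp: max.commute) (metis max.commute)+
  show ?thesis
  proof (cases rule: suspense_step_cases[OF V])
    case v: (1 e)
    show ?thesis
    proof (cases rule: suspense_step_cases[OF W])
      case w: (1 e')
      have "u \<le> max e e'" if "u \<in> ?M" "even u" for u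
        using that v(3) w(3) by (force simp: max_def split: if_splits)
      moreover have "max e e' \<in> ?M" "even (max e e')"
        using v(1,2) w(1,2) by (auto simp: max_def)
      ultimately show ?thesis
        using fin v(4) w(4) by (subst suspense_step_even[of _ "max e e'"]) auto
    next
      case w: (2 m')
      show ?thesis
        using suspense_step_max_mixed[OF V(1) W(1) v(1-3) w(1,2)] v(4) w(3) by simp
    qed
  next
    case v: (2 m)
    show ?thesis
    proof (cases rule: suspense_step_cases[OF W])
      case w: (1 e')
      show ?thesis
        using suspense_step_max_mixed[OF W(1) V(1) w(1-3) v(1,2)] v(3) w(4)
        unfolding comm by (simp add: max.commute)
    next
      case w: (2 m')
      have "odd u \<and> max m m' \<le> u" if "u \<in> ?M" for u
        using that v(2) w(2) by (force simp: max_def)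
      moreover have "max m m' \<in> ?M"
        using v(1) w(1) by blast
      ultimately show ?thesis
        using fin v(3) w(3) by (subst suspense_step_odd[of _ "max m m'"]) auto
    qed
  qed
qed

section \<open>Moves of compound positions\<close>

text \<open>Unlike \<open>options\<close>, the set of moves of a finished position is a singleton, not empty.\<close>

definition moves :: "position \<Rightarrow> position set" where
  "moves G = {\<Sum>\<^sub># N | N. rel_mset (\<lambda>k r. r \<in> component_results k) G N}"

lemma moves_empty: "moves {#} = {{#}}"
  by (auto simp: moves_def rel_mset_Zero dest: rel_mset_size)

lemma moves_add_mset:
  "moves (add_mset k G) = {r + X | r X. r \<in> component_results k \<and> X \<in> moves G}"
proof
  show "moves (add_mset k G) \<subseteq> {r + X | r X. r \<in> component_results k \<and> X \<in> moves G}"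
    by (auto simp: moves_def dest!: msed_rel_invL) blast
  have "r + \<Sum>\<^sub># N \<in> moves (add_mset k G)"
    if "r \<in> component_results k" "rel_mset (\<lambda>k r. r \<in> component_results k) G N" for r N
    using rel_mset_Plus[of "\<lambda>k r. r \<in> component_results k", OF that]
    by (force simp: moves_def)
  then show "{r + X | r X. r \<in> component_results k \<and> X \<in> moves G} \<subseteq> moves (add_mset k G)"
    by (auto simp: moves_def[of G])
qed

text \<open>The two parts move independently. For \<open>options\<close> this product form would
  fail if just one part were finished, since that part would contribute no factor.\<close>

lemma moves_union: "moves (G + H) = {X + Y | X Y. X \<in> moves G \<and> Y \<in> moves H}"
proof (induction G)
  case empty
  show ?case by (simp add: moves_empty)
next
  case (add k G)
  then show ?case
    by (auto simp: moves_add_mset) (metis add.assoc)+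
qed

lemma moves_singleton: "moves {#k#} = component_results k"
  by (simp add: moves_add_mset moves_empty)

lemma finite_moves: "finite (moves G)"
  using finite_choices[of G] by (simp add: moves_def)

lemma moves_nonempty: "moves G \<noteq> {}"
  using choices_nonempty[of G] by (auto simp: moves_def)

lemma moves_terminal: "\<forall>k\<in>#G. k = 0 \<Longrightarrow> moves G = {G}"
  by (induction G) (auto simp: moves_empty moves_add_mset component_results_def)

lemma sum_moves_less: "X \<in> moves G \<Longrightarrow> \<not> (\<forall>k\<in>#G. k = 0) \<Longrightarrow> \<Sum>\<^sub># X < \<Sum>\<^sub># G"
  using sum_choices by (fastforce simp: moves_def)

section \<open>Suspense of a union\<close>

lemma suspense_terminal: "\<forall>k\<in>#G. k = 0 \<Longrightarrow> suspense G = 0"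
  by (subst suspense.simps) (simp add: options_eq_empty_iff)

lemma suspense_eq_step:
  assumes "\<not> (\<forall>k\<in>#G. k = 0)"
  shows "suspense G = suspense_step (suspense ` moves G)"
proof -
  have "options G = moves G"
    using assms by (auto simp: options_def moves_def)
  then show ?thesis
    using moves_nonempty[of G]
    by (subst suspense.simps) (simp add: suspense_step_def Let_def)
qed

text \<open>Induction on the total number of vertices. If neither part is finished, the induction
  hypothesis turns the values of the moves into pairwise maxima, and
  \<open>suspense_step_max\<close> applies.\<close>

theorem suspense_union: "suspense (G + H) = max (suspense G) (suspense H)"
proof (induction "\<Sum>\<^sub># (G + H)" arbitrary: G H rule: less_induct)
  case less
  have *: "suspense (G + H) = max (suspense G) (suspense H)"
    if G: "\<forall>k\<in>#G. k = 0" and H: "\<not> (\<forall>k\<in>#H. k = 0)"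
      and IH: "\<And>Y. Y \<in> moves H \<Longrightarrow> suspense (G + Y) = max (suspense G) (suspense Y)" for G H
  proof -
    \<comment> \<open>A finished \<open>G\<close> has only itself as a move and suspense 0, so it
      does not change the value of any move of \<open>H\<close>.\<close>
    have "suspense ` moves (G + H) = suspense ` moves H"
      using IH suspense_terminal[OF G]
      by (auto simp: moves_union moves_terminal[OF G] image_iff) force
    then show ?thesis
      using H suspense_terminal[OF G]
      by (subst (1 3) suspense_eq_step) auto
  qed
  show ?case
  proof (cases "\<forall>k\<in>#G. k = 0")
    case G: True
    show ?thesis
    proof (cases "\<forall>k\<in>#H. k = 0")
      case True
      then have "\<forall>k\<in>#G + H. k = 0" using G by auto
      then show ?thesis
        using G True by (metis max.idem suspense_terminal)
    next
      case False
      show ?thesis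
        by (rule *[OF G False], rule less) (use sum_moves_less[OF _ False] in auto)
    qed
  next
    case G: False
    show ?thesis
    proof (cases "\<forall>k\<in>#H. k = 0")
      case True
      have "suspense (H + G) = max (suspense H) (suspense G)"
        by (rule *[OF True G], rule less) (use sum_moves_less[OF _ G] in auto)
      then show ?thesis
        by (simp add: add.commute max.commute)
    next
      case H: False
      have IH: "suspense (X + Y) = max (suspense X) (suspense Y)"
        if "X \<in> moves G" "Y \<in> moves H" for X Y
        using sum_moves_less[OF that(1) G] sum_moves_less[OF that(2) H] by (intro less) simp
      have "suspense ` moves (G + H)
          = {max v w | v w. v \<in> suspense ` moves G \<and> w \<in> suspense ` moves H}"
        using IH by (force simp: moves_union)
      moreover have "\<not> (\<forall>k\<in>#G + H. k = 0)"
        using G by auto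
      ultimately have "suspense (G + H)
          = suspense_step {max v w | v w. v \<in> suspense ` moves G \<and> w \<in> suspense ` moves H}"
        by (metis (no_types, lifting) suspense_eq_step)
      also have "\<dots> = max (suspense G) (suspense H)"
        using G H by (subst suspense_step_max)
          (auto simp: finite_moves moves_nonempty suspense_eq_step)
      finally show ?thesis .
    qed
  qed
qed

section \<open>Windows and blocks for single paths\<close>

lemma suspense_path_0: "suspense_path 0 = 0"
  by (simp add: suspense_terminal)

lemma suspense_path_small:
  assumes "1 \<le> k" "k \<le> 3"
  shows "suspense_path k = 1"
proof -
  have step: "suspense_path k = suspense_step (suspense ` nk_results k)" if "k \<noteq> 0" for k
    using that suspense_eq_step[of "{#k#}"]
    by (simp add: moves_singleton component_results_def)
  have "suspense_step {0} = Suc 0"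
    by (rule suspense_step_even) auto
  then have 12: "suspense_path k = 1" if "k = 1 \<or> k = 2" for k
    using that step[of k] by (auto simp: nk_results_def suspense_path_0)
  have "suspense_step {0, 1} = Suc 0"
    by (rule suspense_step_even) auto
  then have "suspense_path 3 = 1"
    using step[of 3] 12[of 1] by (simp add: nk_results_def suspense_path_0)
  moreover have "k = 1 \<or> k = 2 \<or> k = 3"
    using assms by arith
  ultimately show ?thesis
    using 12 by blast
qed

text \<open>The lower end \<open>(k - 2) div 2\<close> is \<open>(k - 3) / 2\<close> rounded up, the
  least possible larger part of a split of \<open>k - 3\<close>. Monotonicity is what lets the
  larger part carry the value of the pair.\<close>

lemma suspense_path_window:
  assumes k: "4 \<le> k" and mono: "\<And>i j. i \<le> j \<Longrightarrow> j < k \<Longrightarrow> suspense_path i \<le> suspense_path j"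
  shows "suspense_path k = suspense_step (suspense_path ` {(k - 2) div 2..k - 2})"
proof -
  have pair: "suspense {#i, j#} = suspense_path j" if "i \<le> j" "j < k" for i j
    using suspense_union[of "{#i#}" "{#j#}"] mono[OF that] by (simp add: max_def add_mset_commute)
  have "suspense ` nk_results k = suspense_path ` {(k - 2) div 2..k - 2}" (is "?L = ?R")
  proof
    show "?L \<subseteq> ?R"
    proof
      fix x
      assume "x \<in> ?L"
      then consider "x = suspense_path (k - 2)" | "x = suspense_path (k - 3)"
        | i j where "x = suspense {#i, j#}" "1 \<le> i" "i \<le> j" "i + j = k - 3"
        using k by (auto simp: nk_results_def)
      then show "x \<in> ?R"
      proof cases
        case 3
        then have "x = suspense_path j" "j \<in> {(k - 2) div 2..k - 2}"
          using k pair[of i j] by auto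
        then show ?thesis by blast
      qed (use k in \<open>auto intro!: imageI\<close>)
    qed
    show "?R \<subseteq> ?L"
    proof
      fix x
      assume "x \<in> ?R"
      then obtain j where j: "x = suspense_path j" "(k - 2) div 2 \<le> j" "j \<le> k - 2"
        by auto
      show "x \<in> ?L"
      \<comment> \<open>Exactly for these \<open>j\<close> is the other part
        \<open>k - 3 - j\<close> nonempty; the two remaining lengths come from moves at an
        end.\<close>
      proof (cases "j \<le> k - 4")
        case True
        define i where "i = k - 3 - j"
        have i: "1 \<le> i" "i \<le> j" "i + j = k - 3" "j < k"
          using True j k by (auto simp: i_def)
        then have "{#i, j#} \<in> nk_results k"
          using k by (auto simp: nk_results_def)
        then show ?thesis
          using pair[of i j] i j(1) by (metis imageI)
      next
        case False
        then have "j = k - 2 \<or> j = k - 3"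
          using j k by auto
        then show ?thesis
          using j(1) k by (auto simp: nk_results_def)
      qed
    qed
  qed
  then show ?thesis
    using k suspense_eq_step[of "{#k#}"]
    by (simp add: moves_singleton component_results_def)
qed

text \<open>The window of \<open>k\<close> contains \<open>A\<close> for
  \<open>A + 2 <= k <= 2 * A + 3\<close>; for \<open>k = A + 1\<close> it stops at
  \<open>A - 1\<close>, hence the second plateau point in \<open>A'\<close>. Its largest even value
  is thus \<open>2 * n\<close>, as beyond \<open>A\<close> only \<open>2 * n + 1\<close> has
  occurred. For \<open>A = 0\<close> the paths are too short for the window lemma.\<close>

lemma suspense_path_odd_block:
  assumes mono: "\<And>i j. i \<le> j \<Longrightarrow> j \<le> A \<Longrightarrow> suspense_path i \<le> suspense_path j"
    and A: "suspense_path A = 2 * n" and A': "A = 0 \<or> 4 < A \<and> suspense_path (A - 1) = 2 * n"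
    and n: "A = 0 \<Longrightarrow> n = 0"
    and k: "A < k" "k \<le> 2 * A + 3"
  shows "suspense_path k = 2 * n + 1"
  using k
proof (induction k rule: less_induct)
  case (less k)
  show ?case
  proof (cases "A = 0")
    case True
    then show ?thesis
      using less.prems n suspense_path_small[of k] by simp
  next
    case False
    then have A': "4 < A" "suspense_path (A - 1) = 2 * n"
      using A' by auto
    have odd: "suspense_path j = 2 * n + 1" if "A < j" "j < k" for j
      using less that by auto
    have le: "suspense_path j \<le> 2 * n" if "j \<le> A" for j
      using mono[OF that] A by simp
    \<comment> \<open>The induction hypothesis extends monotonicity from \<open>A\<close> to all
      lengths below \<open>k\<close>, as the window lemma demands.\<close>
    have "suspense_path i \<le> suspense_path j" if "i \<le> j" "j < k" for i j
      using that mono[of i j] odd[of i] odd[of j] le[of i]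
      by (cases "i \<le> A"; cases "j \<le> A") auto
    then have eq: "suspense_path k = suspense_step (suspense_path ` {(k - 2) div 2..k - 2})"
      using less.prems A'(1) by (intro suspense_path_window) auto
    have "2 * n \<in> suspense_path ` {(k - 2) div 2..k - 2}"
    proof (cases "k = A + 1")
      case True
      then have "A - 1 \<in> {(k - 2) div 2..k - 2}" by auto
      then show ?thesis using A'(2) by force
    next
      case False
      then have "A \<in> {(k - 2) div 2..k - 2}" using less.prems by auto
      then show ?thesis using A by force
    qed
    moreover have "v \<le> 2 * n" if "v \<in> suspense_path ` {(k - 2) div 2..k - 2}" "even v" for v
    proof -
      from that(1) obtain j where j: "v = suspense_path j" "j \<le> k - 2" by auto
      then show ?thesis
        using le[of j] odd[of j] that(2) less.prems by (cases "j \<le> A") auto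
    qed
    ultimately show ?thesis
      unfolding eq by (subst suspense_step_even[of _ "2 * n"]) auto
  qed
qed

text \<open>The windows are \<open>{A + 1..2 * A + 2}\<close> and \<open>{A + 1..2 * A + 3}\<close>,
  both inside the odd block.\<close>

lemma suspense_path_even_block:
  assumes mono: "\<And>i j. i \<le> j \<Longrightarrow> j < 2 * A + 4 \<Longrightarrow> suspense_path i \<le> suspense_path j"
    and odd: "\<And>k. A < k \<Longrightarrow> k \<le> 2 * A + 3 \<Longrightarrow> suspense_path k = 2 * n + 1"
  shows "suspense_path (2 * A + 4) = 2 * n + 2" "suspense_path (2 * A + 5) = 2 * n + 2"
proof -
  have eq: "suspense_path k = 2 * n + 2"
    if "k = 2 * A + 4 \<or> k = 2 * A + 5"
      and "\<And>i j. i \<le> j \<Longrightarrow> j < k \<Longrightarrow> suspense_path i \<le> suspense_path j" for k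
  proof -
    have "suspense_path k = suspense_step (suspense_path ` {(k - 2) div 2..k - 2})"
      using that by (intro suspense_path_window) auto
    also have "suspense_path ` {(k - 2) div 2..k - 2} = {2 * n + 1}"
    proof -
      have "suspense_path j = 2 * n + 1" if "j \<in> {(k - 2) div 2..k - 2}" for j
        using that \<open>k = 2 * A + 4 \<or> k = 2 * A + 5\<close> by (intro odd) auto
      moreover have "{(k - 2) div 2..k - 2} \<noteq> {}" by simp
      ultimately show ?thesis by (simp add: image_constant_conv cong: image_cong_simp)
    qed
    finally show ?thesis
      by (simp add: suspense_step_def)
  qed
  show *: "suspense_path (2 * A + 4) = 2 * n + 2"
    using mono by (intro eq) auto
  show "suspense_path (2 * A + 5) = 2 * n + 2"
  proof (rule eq)
    fix i j
    assume ij: "i \<le> j" "j < 2 * A + 5"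
    \<comment> \<open>The second window needs monotonicity one place further than
      \<open>mono\<close> reaches; the value just found at \<open>2 * A + 4\<close> supplies
      it.\<close>
    show "suspense_path i \<le> suspense_path j"
    proof (cases "j = 2 * A + 4 \<and> i < j")
      case True
      then have "suspense_path i \<le> suspense_path (2 * A + 3)"
        by (intro mono) auto
      then show ?thesis
        using True * odd[of "2 * A + 3"] by simp
    next
      case False
      then show ?thesis
        using ij mono[of i j] by (cases "i = j") auto
    qed
  qed simp
qed

section \<open>Ends of the even plateaus\<close>

definition threshold :: "nat \<Rightarrow> nat" where
  "threshold n = 5 * (2 ^ n - 1)"

lemma threshold_0: "threshold 0 = 0"
  by (simp add: threshold_def)

text \<open>This matches the blocks: the odd one ends at \<open>2 * A + 3\<close> and two even
  places follow.\<close>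

lemma threshold_Suc: "threshold (Suc n) = 2 * threshold n + 5"
proof -
  have "(1::nat) \<le> 2 ^ n" by simp
  then show ?thesis
    by (simp add: threshold_def algebra_simps)
qed

text \<open>Makes monotonicity up to every threshold global, and forces \<open>n = 0\<close> when
  the threshold is 0.\<close>

lemma le_threshold: "n \<le> threshold n"
  by (induction n) (auto simp: threshold_0 threshold_Suc)

text \<open>Monotonicity is carried through the induction because the window lemma needs it, and the
  value before the threshold because the next odd block starts from it. For \<open>n = 0\<close> the
  plateau is the single length 0.\<close>

lemma suspense_path_threshold:
  "mono_on {..threshold n} suspense_path \<and> suspense_path (threshold n) = 2 * n \<and>
   (n = 0 \<or> suspense_path (threshold n - 1) = 2 * n)"
proof (induction n)
  case 0
  show ?case by (auto simp: threshold_0 suspense_path_0 intro!: mono_onI)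
next
  case (Suc n)
  let ?A = "threshold n"
  have mono: "suspense_path i \<le> suspense_path j" if "i \<le> j" "j \<le> ?A" for i j
    using Suc that by (intro mono_onD[of "{..?A}" suspense_path]) auto
  have A: "suspense_path ?A = 2 * n" "?A = 0 \<or> 4 < ?A \<and> suspense_path (?A - 1) = 2 * n"
    using Suc by (cases n; auto simp: threshold_0 threshold_Suc)+
  have odd: "suspense_path k = 2 * n + 1" if "?A < k" "k \<le> 2 * ?A + 3" for k
    using mono A le_threshold[of n] that
    by (intro suspense_path_odd_block[of ?A]) auto
  have mono': "suspense_path i \<le> suspense_path j" if "i \<le> j" "j < 2 * ?A + 4" for i j
    using that mono[of i j] mono[of i ?A] A(1) odd[of i] odd[of j]
    by (cases "i \<le> ?A"; cases "j \<le> ?A") auto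
  have even: "suspense_path (2 * ?A + 4) = 2 * n + 2" "suspense_path (2 * ?A + 5) = 2 * n + 2"
    using suspense_path_even_block[of ?A n] mono' odd by blast+
  have "suspense_path i \<le> suspense_path j" if "i \<le> j" "j \<le> 2 * ?A + 5" for i j
  proof (cases "j < 2 * ?A + 4")
    case True
    then show ?thesis using that mono' by simp
  next
    case False
    then have "j = 2 * ?A + 4 \<or> j = 2 * ?A + 5"
      using that by arith
    then have j: "suspense_path j = 2 * n + 2"
      using even by blast
    show ?thesis
    proof (cases "i < 2 * ?A + 4")
      case True
      then show ?thesis using j mono'[of i "2 * ?A + 3"] odd[of "2 * ?A + 3"] by simp
    next
      case False
      then have "i = 2 * ?A + 4 \<or> i = 2 * ?A + 5" using that by auto
      then show ?thesis using j even by auto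
    qed
  qed
  then show ?case
    using even by (auto simp: threshold_Suc add.commute intro!: mono_onI)
qed

theorem theorem4:
  "mono suspense_path \<and>
   (\<forall>n::nat.
      suspense_path (5 * (2 ^ n - 1)) = 2 * n \<and>
      (\<forall>k. 5 * (2 ^ n - 1) + 1 \<le> k \<and> k \<le> 5 * (2 ^ (n + 1) - 1) - 2 \<longrightarrow>
         suspense_path k = 2 * n + 1) \<and>
      suspense_path (5 * (2 ^ (n + 1) - 1) - 1) = 2 * n + 2)"
proof (intro conjI allI impI)
  show mono: "mono suspense_path"
  proof (rule monoI)
    fix i j :: nat
    assume "i \<le> j"
    then show "suspense_path i \<le> suspense_path j"
      using suspense_path_threshold[of j] le_threshold[of j]
      by (intro mono_onD[of "{..threshold j}" suspense_path]) auto
  qed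
  fix n :: nat
  show "suspense_path (5 * (2 ^ n - 1)) = 2 * n"
    using suspense_path_threshold[of n] by (simp add: threshold_def)
  show "suspense_path (5 * (2 ^ (n + 1) - 1) - 1) = 2 * n + 2"
    using suspense_path_threshold[of "Suc n"] by (simp add: threshold_def)
  fix k :: nat
  assume k: "5 * (2 ^ n - 1) + 1 \<le> k \<and> k \<le> 5 * (2 ^ (n + 1) - 1) - 2"
  \<comment> \<open>The upper bound is \<open>threshold (Suc n) - 2\<close>, which the recursion
    turns into \<open>2 * threshold n + 3\<close>.\<close>
  have k': "threshold n < k" "k \<le> 2 * threshold n + 3"
    using k threshold_Suc[of n] by (auto simp: threshold_def)
  show "suspense_path k = 2 * n + 1"
  proof (rule suspense_path_odd_block[OF _ _ _ _ k'])
    show "threshold n = 0 \<or> 4 < threshold n \<and> suspense_path (threshold n - 1) = 2 * n"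
      using suspense_path_threshold[of n] by (cases n) (auto simp: threshold_0 threshold_Suc)
  qed (use mono suspense_path_threshold[of n] le_threshold[of n] in \<open>auto dest: monoD\<close>)
qed

end
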